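(* Let $t$ be a closed term. The following are equivalent: (1) $t$ is $\rhd\beta_v$-normalizable; (2) $t$ reduces by finitely many $\rhd\beta_v$-steps to some closed value $v$; (3) $t\simeq_{\beta_v}v$ for some closed value $v$; (4) $[\![t]\!]_{\vec{x}}\neq\emptyset$ for any list $\vec{x}=(x_1,\dots,x_k)$ ($k\in\mathbb{N}$) of pairwise distinct variables; (5) $((\mathbf{0},\dots,\mathbf{0}),\mathbf{0})\in[\![t]\!]_{\vec{x}}$ (with $k$ copies of $\mathbf{0}$) for any list $\vec{x}=(x_1,\dots,x_k)$ ($k\in\mathbb{N}$) of pairwise distinct variables; (6) there exists a derivation with conclusion $\vdash t\colon\mathbf{0}$ (empty environment); (7) there exists a derivation with conclusion $\vdash t\colon Q$ (empty environment) for some positive type $Q$; (8) $t$ is strongly $\rhd\beta_v$-normalizable.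
   Context: Terms: $t ::= x \mid \lambda x.t \mid tu$ (up to $\alpha$); values $v ::= x \mid \lambda x.t$; a term is closed if it has no free variables; $t\{v/x\}$ substitution. Root step ($\beta_v$): $(\lambda x.t)v \mapsto t\{v/x\}$ with $v$ a value. Balanced contexts $B ::= [\cdot] \mid (\lambda x.B)t \mid Bt \mid tB$; $\rhd\beta_v$-reduction is the closure of the root step under balanced contexts; $\beta_v$-reduction is its closure under arbitrary contexts (including under $\lambda$), and $\simeq_{\beta_v}$ the reflexive-symmetric-transitive closure of $\beta_v$-reduction. Types: positive types are finite multisets $[(P_1,Q_1),\dots,(P_n,Q_n)]$ of pairs of positive types ($\mathbf{0}$ empty, $\uplus$ union). Environments map variables to positive types (finitely many non-$\mathbf{0}$), combined pointwise by $\uplus$. Rules: (ax) $x\colon P\vdash x\colon P$; ($\lambda$) from $\Gamma_i,x\colon P_i\vdash t\colon Q_i$ ($1\le i\le n$, $n\ge0$) infer $\biguplus_i\Gamma_i\vdash\lambda x.t\colon[(P_1,Q_1),\dots,(P_n,Q_n)]$; ($@$) from $\Gamma\vdash t\colon[(P,Q)]$ and $\Delta\vdash u\colon P$ infer $\Gamma\uplus\Delta\vdash tu\colon Q$. Relational semantics: $[\![t]\!]_{\vec{x}}=\{((P_1,\dots,P_k),Q)\mid x_1\colon P_1,\dots,x_k\colon P_k\vdash t\colon Q\text{ derivable}\}$. *)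

theory Defs
  imports "HOL-Library.Multiset"
begin

text \<open>Terms up to renaming of bound variables, in de Bruijn notation. The variables are the
  natural numbers: under \<open>k\<close> abstractions, index \<open>k + i\<close> refers to the free variable \<open>i\<close>.\<close>

datatype tm = Var nat | Lam tm | App tm tm

fun fv :: "tm \<Rightarrow> nat set" where
  "fv (Var i) = {i}"
| "fv (Lam t) = {i. Suc i \<in> fv t}"
| "fv (App t u) = fv t \<union> fv u"

definition closed_tm :: "tm \<Rightarrow> bool" where
  "closed_tm t \<longleftrightarrow> fv t = {}"

fun is_value :: "tm \<Rightarrow> bool" where
  "is_value (Var i) \<longleftrightarrow> True"
| "is_value (Lam t) \<longleftrightarrow> True"
| "is_value (App t u) \<longleftrightarrow> False"

fun lift :: "nat \<Rightarrow> tm \<Rightarrow> tm" where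
  "lift k (Var i) = (if i < k then Var i else Var (Suc i))"
| "lift k (Lam t) = Lam (lift (Suc k) t)"
| "lift k (App t u) = App (lift k t) (lift k u)"

text \<open>\<open>subst k v t\<close> replaces the variable \<open>k\<close> of \<open>t\<close> by \<open>v\<close> and removes \<open>k\<close> from the
  variables in scope, so that the larger indices are decremented.\<close>

fun subst :: "nat \<Rightarrow> tm \<Rightarrow> tm \<Rightarrow> tm" where
  "subst k v (Var i) = (if i < k then Var i else if i = k then v else Var (i - 1))"
| "subst k v (Lam t) = Lam (subst (Suc k) (lift 0 v) t)"
| "subst k v (App t u) = App (subst k v t) (subst k v u)"

inductive root_bv :: "tm \<Rightarrow> tm \<Rightarrow> bool" where
  "is_value v \<Longrightarrow> root_bv (App (Lam t) v) (subst 0 v t)"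

datatype ctx = Hole | CLam ctx | CAppL ctx tm | CAppR tm ctx

text \<open>Filling the hole may capture variables: no index is shifted.\<close>

fun plug :: "ctx \<Rightarrow> tm \<Rightarrow> tm" where
  "plug Hole t = t"
| "plug (CLam C) t = Lam (plug C t)"
| "plug (CAppL C u) t = App (plug C t) u"
| "plug (CAppR u C) t = App u (plug C t)"

inductive balanced :: "ctx \<Rightarrow> bool" where
  "balanced Hole"
| "balanced B \<Longrightarrow> balanced (CAppL (CLam B) t)"
| "balanced B \<Longrightarrow> balanced (CAppL B t)"
| "balanced B \<Longrightarrow> balanced (CAppR t B)"

definition bal_bv :: "tm \<Rightarrow> tm \<Rightarrow> bool" where
  "bal_bv t u \<longleftrightarrow> (\<exists>B r s. balanced B \<and> root_bv r s \<and> t = plug B r \<and> u = plug B s)"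

definition bv :: "tm \<Rightarrow> tm \<Rightarrow> bool" where
  "bv t u \<longleftrightarrow> (\<exists>C r s. root_bv r s \<and> t = plug C r \<and> u = plug C s)"

definition normal_for :: "('a \<Rightarrow> 'a \<Rightarrow> bool) \<Rightarrow> 'a \<Rightarrow> bool" where
  "normal_for R t \<longleftrightarrow> \<not> (\<exists>u. R t u)"

definition normalizable :: "('a \<Rightarrow> 'a \<Rightarrow> bool) \<Rightarrow> 'a \<Rightarrow> bool" where
  "normalizable R t \<longleftrightarrow> (\<exists>u. R\<^sup>*\<^sup>* t u \<and> normal_for R u)"

definition strongly_normalizable :: "('a \<Rightarrow> 'a \<Rightarrow> bool) \<Rightarrow> 'a \<Rightarrow> bool" where
  "strongly_normalizable R t \<longleftrightarrow> \<not> (\<exists>f :: nat \<Rightarrow> 'a. f 0 = t \<and> (\<forall>i. R (f i) (f (Suc i))))"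

datatype ptype = Pos (arrows: "(ptype \<times> ptype) multiset")

text \<open>\<open>0\<close> is the empty positive type and \<open>+\<close> is multiset union of positive types.\<close>

instantiation ptype :: comm_monoid_add
begin

definition zero_ptype :: ptype where
  "0 = Pos {#}"

definition plus_ptype :: "ptype \<Rightarrow> ptype \<Rightarrow> ptype" where
  "P + Q = Pos (arrows P + arrows Q)"

instance
  by standard (auto simp: zero_ptype_def plus_ptype_def ac_simps)

end

text \<open>Derivable environments have finite support, see \<open>derivable_finite_support\<close> below.\<close>

type_synonym env = "nat \<Rightarrow> ptype"

definition env_of :: "nat list \<Rightarrow> ptype list \<Rightarrow> env" where
  "env_of xs Ps = (\<lambda>y. case map_of (zip xs Ps) y of None \<Rightarrow> 0 | Some P \<Rightarrow> P)"

text \<open>The environment \<open>case_nat P \<Gamma>\<close> gives type \<open>P\<close> to the variable bound by the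
  abstraction (index \<open>0\<close> in its body) and extends \<open>\<Gamma>\<close>.\<close>

inductive derivable :: "env \<Rightarrow> tm \<Rightarrow> ptype \<Rightarrow> bool" where
  ax: "derivable (env_of [x] [P]) (Var x) P"
| lam: "(\<And>i. i < n \<Longrightarrow> derivable (case_nat (P i) (\<Gamma> i)) t (Q i)) \<Longrightarrow>
    derivable (\<lambda>y. \<Sum>i<n. \<Gamma> i y) (Lam t) (Pos (mset (map (\<lambda>i. (P i, Q i)) [0..<n])))"
| app: "derivable \<Gamma> t (Pos {#(P, Q)#}) \<Longrightarrow> derivable \<Delta> u P \<Longrightarrow>
    derivable (\<lambda>y. \<Gamma> y + \<Delta> y) (App t u) Q"

lemma derivable_finite_support:
  "derivable \<Gamma> t Q \<Longrightarrow> finite {x. \<Gamma> x \<noteq> 0}"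
proof (induction rule: derivable.induct)
  case (ax x P)
  have "{y. env_of [x] [P] y \<noteq> 0} \<subseteq> {x}"
    by (auto simp: env_of_def split: if_splits)
  then show ?case
    using finite_subset by blast
next
  case (lam n P \<Gamma> t Q)
  have "finite {x. \<Gamma> i x \<noteq> 0}" if "i < n" for i
  proof -
    have "finite (Suc ` {x. \<Gamma> i x \<noteq> 0})"
      by (rule finite_subset[OF _ lam.IH[OF that]]) auto
    then show ?thesis
      by (simp add: finite_image_iff)
  qed
  then have "finite (\<Union>i<n. {x. \<Gamma> i x \<noteq> 0})"
    by blast
  moreover have "{x. (\<Sum>i<n. \<Gamma> i x) \<noteq> 0} \<subseteq> (\<Union>i<n. {x. \<Gamma> i x \<noteq> 0})"
    using sum.neutral by fastforce
  ultimately show ?case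
    using finite_subset by blast
next
  case (app \<Gamma> t P Q \<Delta> u)
  have "{x. \<Gamma> x + \<Delta> x \<noteq> 0} \<subseteq> {x. \<Gamma> x \<noteq> 0} \<union> {x. \<Delta> x \<noteq> 0}"
    by auto
  with app.IH show ?case
    using finite_subset by blast
qed

definition sem :: "nat list \<Rightarrow> tm \<Rightarrow> (ptype list \<times> ptype) set" where
  "sem xs t = {(Ps, Q) | Ps Q. length Ps = length xs \<and> derivable (env_of xs Ps) t Q}"

end

theory Submission
  imports Defs "HOL-Library.Function_Algebras"
begin

text \<open>Count the application rules of a derivation. Because a value of type \<open>P + Q\<close> splits into a
  derivation of type \<open>P\<close> and one of type \<open>Q\<close> without changing this count, firing a
  \<open>\<beta>\<^sub>v\<close>-redex preserves types and lowers the count by exactly one, and conversely for expansion.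
  In a balanced context the hole is typed exactly once, so the count bounds the length of all
  balanced reductions. Under an arbitrary context typability is still invariant, and every
  value has type \<open>0\<close> in the empty environment. Finally, closed balanced normal forms are values.\<close>

section \<open>Sized derivations\<close>

text \<open>The rule for abstractions is split into a nullary rule and one that adds a single premise,
  so that multisets of premises are handled by rule induction.\<close>

inductive sized :: "nat \<Rightarrow> env \<Rightarrow> tm \<Rightarrow> ptype \<Rightarrow> bool" where
  sized_var: "sized 0 (env_of [x] [P]) (Var x) P"
| sized_lam0: "sized 0 0 (Lam t) 0"
| sized_lamS: "sized m (case_nat P \<Gamma>) t Q \<Longrightarrow> sized n \<Delta> (Lam t) R \<Longrightarrow>
    sized (m + n) (\<Gamma> + \<Delta>) (Lam t) (Pos {#(P, Q)#} + R)"
| sized_app: "sized m \<Gamma> t (Pos {#(P, Q)#}) \<Longrightarrow> sized n \<Delta> u P \<Longrightarrow>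
    sized (Suc (m + n)) (\<Gamma> + \<Delta>) (App t u) Q"

text \<open>As simp rules these also fire on unapplied sums of environments, after eta-expansion.\<close>

declare plus_fun_apply [simp del] zero_fun_apply [simp del]

inductive_cases sized_VarE: "sized m \<Gamma> (Var x) P"
inductive_cases sized_LamE: "sized m \<Gamma> (Lam t) P"
inductive_cases sized_AppE: "sized m \<Gamma> (App t u) P"

section \<open>Arithmetic of positive types and environments\<close>

lemma arrows_0 [simp]: "arrows 0 = {#}"
  by (simp add: zero_ptype_def)

lemma arrows_plus [simp]: "arrows (P + Q) = arrows P + arrows Q"
  by (simp add: plus_ptype_def)

lemma ptype_eq_iff: "P = Q \<longleftrightarrow> arrows P = arrows Q"
  by (cases P; cases Q) simp

lemma ptype_0_eq_plus_iff [simp]: "0 = (P :: ptype) + Q \<longleftrightarrow> P = 0 \<and> Q = 0"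
  by (auto simp: ptype_eq_iff)

lemma Pos_eq_0_iff [simp]: "Pos M = 0 \<longleftrightarrow> M = {#}"
  by (simp add: zero_ptype_def)

lemma env_of_single: "env_of [x] [P] = (\<lambda>y. if y = x then P else 0)"
  by (auto simp: env_of_def)

lemma env_of_single_plus: "env_of [x] [P + Q] = env_of [x] [P] + env_of [x] [Q]"
  by (auto simp: env_of_single plus_fun_apply)

lemma case_nat_plus: "case_nat P \<Gamma> + case_nat Q \<Delta> = case_nat (P + Q) (\<Gamma> + \<Delta>)"
  by (rule ext) (simp add: plus_fun_apply split: nat.split)

lemma case_nat_eq_iff: "case_nat P \<Gamma> = \<Delta> \<longleftrightarrow> P = \<Delta> 0 \<and> \<Gamma> = (\<lambda>i. \<Delta> (Suc i))"
  by (auto simp: fun_eq_iff split: nat.split)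

section \<open>Agreement of the counted rules with the given typing rules\<close>

lemma derivable_LamD:
  assumes "derivable \<Gamma> (Lam t) R"
  shows "\<exists>n P \<Delta> Q. (\<forall>i<n. derivable (case_nat (P i) (\<Delta> i)) t (Q i)) \<and>
    \<Gamma> = (\<lambda>y. \<Sum>i<n. \<Delta> i y) \<and> R = Pos (mset (map (\<lambda>i. (P i, Q i)) [0..<n]))"
  using assms
proof (cases rule: derivable.cases)
  case (lam n P \<Delta> Q)
  then show ?thesis
    by (intro exI[of _ n] exI[of _ P] exI[of _ \<Delta>] exI[of _ Q]) simp
qed

text \<open>Translates the n-ary abstraction rule: induction on the number of premises, the last one
  being added by \<open>sized_lamS\<close> to the derivation built from the others.\<close>

lemma sized_Lam_sum:
  assumes "\<And>i. i < n \<Longrightarrow> \<exists>m. sized m (case_nat (P i) (\<Gamma> i)) t (Q i)"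
  shows "\<exists>m. sized m (\<lambda>y. \<Sum>i<n. \<Gamma> i y) (Lam t) (Pos (mset (map (\<lambda>i. (P i, Q i)) [0..<n])))"
  using assms
proof (induction n)
  case 0
  then show ?case
    using sized_lam0[of t] by (auto simp: zero_fun_def zero_ptype_def)
next
  case (Suc n)
  obtain m where m: "sized m (case_nat (P n) (\<Gamma> n)) t (Q n)"
    using Suc.prems by blast
  obtain k where k: "sized k (\<lambda>y. \<Sum>i<n. \<Gamma> i y) (Lam t)
      (Pos (mset (map (\<lambda>i. (P i, Q i)) [0..<n])))"
    using Suc by (meson less_Suc_eq)
  show ?case
    using sized_lamS[OF m k] by (auto simp: plus_fun_def plus_ptype_def add.commute)
qed

lemma derivable_Lam_insert:
  assumes "derivable (case_nat P \<Gamma>) t Q" and "derivable \<Delta> (Lam t) R"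
  shows "derivable (\<Gamma> + \<Delta>) (Lam t) (Pos {#(P, Q)#} + R)"
proof -
  obtain n P' \<Delta>' Q' where *: "\<forall>i<n. derivable (case_nat (P' i) (\<Delta>' i)) t (Q' i)"
    "\<Delta> = (\<lambda>y. \<Sum>i<n. \<Delta>' i y)" "R = Pos (mset (map (\<lambda>i. (P' i, Q' i)) [0..<n]))"
    using derivable_LamD[OF assms(2)] by blast
  \<comment> \<open>The new premise gets the fresh index \<open>n\<close>, so the families are
    unchanged below \<open>n\<close> and the old premises can be reused as they are.\<close>
  let ?P = "P'(n := P)" and ?Q = "Q'(n := Q)" and ?\<Gamma> = "\<Delta>'(n := \<Gamma>)"
  have "derivable (\<lambda>y. \<Sum>i<Suc n. ?\<Gamma> i y) (Lam t)
      (Pos (mset (map (\<lambda>i. (?P i, ?Q i)) [0..<Suc n])))"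
    by (rule derivable.lam) (use *(1) assms(1) in \<open>auto simp: less_Suc_eq\<close>)
  moreover have "(\<lambda>y. \<Sum>i<Suc n. ?\<Gamma> i y) = \<Gamma> + \<Delta>"
    by (rule ext) (simp add: *(2) add.commute plus_fun_apply)
  moreover have "Pos (mset (map (\<lambda>i. (?P i, ?Q i)) [0..<Suc n])) = Pos {#(P, Q)#} + R"
    by (auto simp: *(3) plus_ptype_def simp del: mset_map intro!: arg_cong[where f = mset])
  ultimately show ?thesis by simp
qed

lemma derivable_imp_sized: "derivable \<Gamma> t Q \<Longrightarrow> \<exists>m. sized m \<Gamma> t Q"
proof (induction rule: derivable.induct)
  case (ax x P)
  show ?case
    using sized_var by blast
next
  case (lam n P \<Gamma> t Q)
  show ?case
    by (rule sized_Lam_sum) (rule lam.IH)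
next
  case (app \<Gamma> t P Q \<Delta> u)
  then obtain m n where "sized m \<Gamma> t (Pos {#(P, Q)#})" "sized n \<Delta> u P"
    by blast
  from sized_app[OF this] show ?case
    by (auto simp: plus_fun_def)
qed

lemma sized_imp_derivable: "sized m \<Gamma> t Q \<Longrightarrow> derivable \<Gamma> t Q"
proof (induction rule: sized.induct)
  case (sized_var x P)
  show ?case
    by (rule derivable.ax)
next
  case (sized_lam0 t)
  show ?case
    using derivable.lam[of 0] by (simp add: zero_fun_def zero_ptype_def)
next
  case (sized_lamS m P \<Gamma> t Q n \<Delta> R)
  then show ?case
    by (intro derivable_Lam_insert)
next
  case (sized_app m \<Gamma> t P Q n \<Delta> u)
  then show ?case
    using derivable.app by (simp add: plus_fun_def)
qed

lemma derivable_iff_sized: "derivable \<Gamma> t Q \<longleftrightarrow> (\<exists>m. sized m \<Gamma> t Q)"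
  using derivable_imp_sized sized_imp_derivable by blast

section \<open>Typing values\<close>

text \<open>Induction on the first derivation: its premises are added one at a time to the second,
  starting from the second alone.\<close>

lemma sized_Lam_merge:
  assumes "sized m \<Gamma> (Lam t) P" and "sized n \<Delta> (Lam t) Q"
  shows "sized (m + n) (\<Gamma> + \<Delta>) (Lam t) (P + Q)"
  using assms
proof (induction m \<Gamma> "Lam t" P)
  case (sized_lamS m P \<Gamma> Q' k \<Delta>' R)
  show ?case
    using sized.sized_lamS[OF sized_lamS(1) sized_lamS(4)[OF sized_lamS(5)]]
    by (simp add: add.assoc)
qed simp

lemma sized_value_0:
  assumes "is_value v"
  shows "sized 0 0 v 0"
proof (cases v)
  case (Var x)
  have "env_of [x] [0] = 0" by (auto simp: env_of_single zero_fun_apply)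
  then show ?thesis using sized_var[of x 0] Var by simp
qed (use assms sized_lam0 in auto)

text \<open>Only an axiom at type \<open>0\<close> or the nullary abstraction rule can give this
  type. Hence a value substituted where nothing is demanded of it contributes neither count nor
  environment.\<close>

lemma sized_value_0D:
  assumes "sized m \<Gamma> v 0" and "is_value v"
  shows "m = 0 \<and> \<Gamma> = 0"
  using assms by cases (auto simp: env_of_single zero_fun_apply)

text \<open>Every premise yields one arrow of the total multiset, and that arrow can be charged to
  \<open>P\<close> or to \<open>Q\<close>. The premise follows its arrow, and the induction
  hypothesis splits the rest.\<close>

lemma sized_Lam_split:
  assumes "sized m \<Gamma> (Lam t) (P + Q)"
  shows "\<exists>m1 m2 \<Gamma>1 \<Gamma>2. m = m1 + m2 \<and> \<Gamma> = \<Gamma>1 + \<Gamma>2 \<and>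
    sized m1 \<Gamma>1 (Lam t) P \<and> sized m2 \<Gamma>2 (Lam t) Q"
  using assms
proof (induction m \<Gamma> "Lam t" "P + Q" arbitrary: P Q)
  case sized_lam0
  then show ?case
    using sized.sized_lam0[of t] by (metis add_0 ptype_0_eq_plus_iff)
next
  case (sized_lamS m A \<Gamma> B k \<Delta> R)
  have eq: "add_mset (A, B) (arrows R) = arrows P + arrows Q"
    using sized_lamS(5) by (simp add: ptype_eq_iff)
  then have "(A, B) \<in># arrows P \<or> (A, B) \<in># arrows Q"
    by (metis union_iff union_single_eq_member)
  then show ?case
  proof
    assume "(A, B) \<in># arrows P"
    then obtain M where M: "arrows P = add_mset (A, B) M"
      by (metis insert_DiffM)
    then have P: "P = Pos {#(A, B)#} + Pos M"
      by (simp add: ptype_eq_iff)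
    have "R = Pos M + Q"
      using eq M by (simp add: ptype_eq_iff)
    then obtain m1 m2 \<Gamma>1 \<Gamma>2 where "k = m1 + m2" "\<Delta> = \<Gamma>1 + \<Gamma>2"
      "sized m1 \<Gamma>1 (Lam t) (Pos M)" "sized m2 \<Gamma>2 (Lam t) Q"
      using sized_lamS(4) by blast
    then show ?case
      using sized.sized_lamS[OF sized_lamS(1)] P by (metis add.assoc)
  next
    assume "(A, B) \<in># arrows Q"
    then obtain M where M: "arrows Q = add_mset (A, B) M"
      by (metis insert_DiffM)
    then have Q: "Q = Pos {#(A, B)#} + Pos M"
      by (simp add: ptype_eq_iff)
    have "R = P + Pos M"
      using eq M by (simp add: ptype_eq_iff)
    then obtain m1 m2 \<Gamma>1 \<Gamma>2 where "k = m1 + m2" "\<Delta> = \<Gamma>1 + \<Gamma>2"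
      "sized m1 \<Gamma>1 (Lam t) P" "sized m2 \<Gamma>2 (Lam t) (Pos M)"
      using sized_lamS(4) by blast
    then show ?case
      using sized.sized_lamS[OF sized_lamS(1)] Q by (metis add.left_commute)
  qed
qed

lemma sized_value_merge:
  assumes "sized m \<Gamma> v P" and "sized n \<Delta> v Q" and "is_value v"
  shows "sized (m + n) (\<Gamma> + \<Delta>) v (P + Q)"
proof (cases v)
  case (Var x)
  then show ?thesis
    using assms
    by (auto elim!: sized_VarE simp: env_of_single_plus[symmetric] intro: sized_var)
qed (use assms sized_Lam_merge in auto)

lemma sized_value_split:
  assumes "sized m \<Gamma> v (P + Q)" and "is_value v"
  obtains m1 m2 \<Gamma>1 \<Gamma>2 where "m = m1 + m2" "\<Gamma> = \<Gamma>1 + \<Gamma>2" "sized m1 \<Gamma>1 v P" "sized m2 \<Gamma>2 v Q"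
proof (cases v)
  case (Var x)
  then have "m = 0 + 0" "\<Gamma> = env_of [x] [P] + env_of [x] [Q]"
    using assms by (auto elim!: sized_VarE simp: env_of_single_plus)
  then show ?thesis
    using that sized_var Var by blast
next
  case (Lam t)
  then show ?thesis
    using sized_Lam_split that assms(1) by blast
qed (use assms in auto)

text \<open>A singleton multiset leaves room for one premise; the remaining part of the derivation
  has type \<open>0\<close> and therefore count 0. This is the form in which the function part of an
  application uses an abstraction.\<close>

lemma sized_Lam_single_iff:
  "sized m \<Gamma> (Lam t) (Pos {#(P, Q)#}) \<longleftrightarrow> sized m (case_nat P \<Gamma>) t Q"
proof
  assume "sized m \<Gamma> (Lam t) (Pos {#(P, Q)#})"
  then show "sized m (case_nat P \<Gamma>) t Q"
  proof (rule sized_LamE)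
    fix m' A \<Gamma>' B n \<Delta> R
    assume *: "m = m' + n" "\<Gamma> = \<Gamma>' + \<Delta>" "Pos {#(P, Q)#} = Pos {#(A, B)#} + R"
      "sized m' (case_nat A \<Gamma>') t B" "sized n \<Delta> (Lam t) R"
    then have "A = P" "B = Q" "R = 0"
      by (auto simp: ptype_eq_iff)
    with * show ?thesis
      using sized_value_0D[of n \<Delta> "Lam t"] by simp
  qed simp
next
  assume "sized m (case_nat P \<Gamma>) t Q"
  from sized_lamS[OF this sized_lam0] show "sized m \<Gamma> (Lam t) (Pos {#(P, Q)#})"
    by simp
qed

section \<open>Lifting and substitution\<close>

definition env_insert :: "nat \<Rightarrow> env \<Rightarrow> env" where
  "env_insert k \<Gamma> = (\<lambda>i. if i < k then \<Gamma> i else if i = k then 0 else \<Gamma> (i - 1))"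

text \<open>The action of \<open>subst k\<close> on environments. The entry at \<open>k\<close> is
  dropped; it is the type at which the substituted value must be derived.\<close>

definition env_delete :: "nat \<Rightarrow> env \<Rightarrow> env" where
  "env_delete k \<Gamma> = (\<lambda>i. if i < k then \<Gamma> i else \<Gamma> (Suc i))"

lemma env_insert_0 [simp]: "env_insert k 0 = 0"
  by (auto simp: env_insert_def zero_fun_apply)

lemma env_delete_0 [simp]: "env_delete k 0 = 0"
  by (auto simp: env_delete_def zero_fun_apply)

lemma env_insert_plus: "env_insert k (\<Gamma> + \<Delta>) = env_insert k \<Gamma> + env_insert k \<Delta>"
  by (auto simp: env_insert_def plus_fun_apply)

lemma env_delete_plus: "env_delete k (\<Gamma> + \<Delta>) = env_delete k \<Gamma> + env_delete k \<Delta>"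
  by (auto simp: env_delete_def plus_fun_apply)

lemma env_insert_Suc: "env_insert (Suc k) (case_nat P \<Gamma>) = case_nat P (env_insert k \<Gamma>)"
  by (rule ext) (auto simp: env_insert_def split: nat.split)

lemma env_delete_Suc: "env_delete (Suc k) (case_nat P \<Gamma>) = case_nat P (env_delete k \<Gamma>)"
  by (rule ext) (auto simp: env_delete_def split: nat.split)

lemma env_insert_zero: "env_insert 0 \<Gamma> = case_nat 0 \<Gamma>"
  by (rule ext) (auto simp: env_insert_def split: nat.split)

lemma env_delete_zero: "env_delete 0 (case_nat P \<Gamma>) = \<Gamma>"
  by (rule ext) (auto simp: env_delete_def)

lemma env_insert_single:
  "env_insert k (env_of [x] [P]) = env_of [if x < k then x else Suc x] [P]"
  by (rule ext) (auto simp: env_insert_def env_of_single)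

lemma is_value_lift [simp]: "is_value (lift k v) = is_value v"
  by (cases v) auto

lemma sized_lift: "sized m \<Gamma> t Q \<Longrightarrow> sized m (env_insert k \<Gamma>) (lift k t) Q"
proof (induction arbitrary: k rule: sized.induct)
  case (sized_var x P)
  then show ?case
    using sized.sized_var[of "if x < k then x else Suc x" P] by (auto simp: env_insert_single)
next
  case (sized_lamS m P \<Gamma> t Q n \<Delta> R)
  show ?case
    using sized.sized_lamS[of m P "env_insert k \<Gamma>" "lift (Suc k) t"] sized_lamS.IH(1)[of "Suc k"]
      sized_lamS.IH(2)[of k]
    by (simp add: env_insert_plus env_insert_Suc)
qed (auto simp: env_insert_plus intro: sized_lam0 sized_app)

text \<open>The index \<open>k\<close> does not occur in the lifted term, and the rules admit no
  weakening, so the environment must be \<open>0\<close> there and comes from an unlifted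
  one.\<close>

lemma sized_unlift:
  assumes "sized m \<Gamma> (lift k t) Q"
  shows "\<exists>\<Delta>. \<Gamma> = env_insert k \<Delta> \<and> sized m \<Delta> t Q"
  using assms
proof (induction t arbitrary: m \<Gamma> k Q)
  case (Var x)
  then have "sized m \<Gamma> (Var (if x < k then x else Suc x)) Q"
    by (simp split: if_splits)
  then show ?case
    by (auto elim!: sized_VarE simp del: if_split simp: env_insert_single[symmetric]
        intro: sized_var)
next
  case (Lam t)
  have "sized m \<Gamma> (Lam (lift (Suc k) t)) Q"
    using Lam.prems by simp
  \<comment> \<open>The outer structural induction handles the body; this inner rule induction runs
    through the premises of the abstraction.\<close>
  then show ?case
  proof (induction m \<Gamma> "Lam (lift (Suc k) t)" Q)
    case sized_lam0
    then show ?case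
      using sized.sized_lam0 by (metis env_insert_0)
  next
    case (sized_lamS m P \<Gamma> Q n \<Delta> R)
    obtain \<Gamma>' where \<Gamma>': "case_nat P \<Gamma> = env_insert (Suc k) \<Gamma>'" "sized m \<Gamma>' t Q"
      using Lam.IH sized_lamS(1) by blast
    obtain \<Delta>' where \<Delta>': "\<Delta> = env_insert k \<Delta>'" "sized n \<Delta>' (Lam t) R"
      using sized_lamS(4) by blast
    define \<Gamma>'' where "\<Gamma>'' = (\<lambda>i. \<Gamma>' (Suc i))"
    have "\<Gamma>' = case_nat (\<Gamma>' 0) \<Gamma>''"
      using case_nat_eq_iff[of "\<Gamma>' 0" \<Gamma>'' \<Gamma>'] by (simp add: \<Gamma>''_def)
    moreover from \<Gamma>'(1) have "case_nat P \<Gamma> = case_nat (\<Gamma>' 0) (env_insert k \<Gamma>'')"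
      by (subst (asm) calculation) (simp add: env_insert_Suc)
    then have "\<Gamma>' 0 = P" "env_insert k \<Gamma>'' = \<Gamma>"
      by (simp_all add: case_nat_eq_iff)
    ultimately have "sized m (case_nat P \<Gamma>'') t Q" "\<Gamma> = env_insert k \<Gamma>''"
      using \<Gamma>'(2) by auto
    then show ?case
      using sized.sized_lamS[OF _ \<Delta>'(2)] \<Delta>'(1) by (metis env_insert_plus)
  qed
next
  case (App t u)
  from App.prems have "sized m \<Gamma> (App (lift k t) (lift k u)) Q"
    by simp
  then obtain m1 m2 \<Gamma>1 \<Gamma>2 P where *: "m = Suc (m1 + m2)" "\<Gamma> = \<Gamma>1 + \<Gamma>2"
    "sized m1 \<Gamma>1 (lift k t) (Pos {#(P, Q)#})" "sized m2 \<Gamma>2 (lift k u) P"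
    by (auto elim: sized_AppE)
  then show ?case
    using App.IH(1)[OF *(3)] App.IH(2)[OF *(4)] sized_app by (metis env_insert_plus)
qed

text \<open>The type \<open>\<Gamma> k\<close> is the sum of what all axioms for \<open>k\<close>
  demand. The derivation of \<open>v\<close> is split along the rules of \<open>t\<close> and its
  pieces replace these axioms; as axioms count 0, the counts add up exactly.\<close>

lemma sized_subst:
  assumes "sized m \<Gamma> t Q" and "is_value v" and "sized n \<Delta> v (\<Gamma> k)"
  shows "sized (m + n) (env_delete k \<Gamma> + \<Delta>) (subst k v t) Q"
  using assms
proof (induction arbitrary: k v n \<Delta> rule: sized.induct)
  case (sized_var x P)
  show ?case
  proof (cases "x = k")
    case True
    have "env_delete k (env_of [k] [P]) = 0"
      by (rule ext) (auto simp: env_delete_def env_of_single zero_fun_apply)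
    then show ?thesis
      using sized_var True by (simp add: env_of_single)
  next
    case False
    let ?y = "if x < k then x else x - 1"
    \<comment> \<open>Another variable demands type \<open>0\<close> at \<open>k\<close>, so the
      derivation of \<open>v\<close> is trivial.\<close>
    have "n = 0 \<and> \<Delta> = 0"
      using sized_var False by (auto simp: env_of_single dest: sized_value_0D)
    moreover have "env_delete k (env_of [x] [P]) = env_of [?y] [P]"
      using False by (intro ext) (auto simp: env_delete_def env_of_single)
    moreover have "subst k v (Var x) = Var ?y"
      using False by simp
    ultimately show ?thesis
      using sized.sized_var[of ?y P] by simp
  qed
next
  case (sized_lam0 t)
  then show ?case
    using sized.sized_lam0 by (auto simp: zero_fun_apply[of k] dest: sized_value_0D)
next
  case (sized_lamS m P \<Gamma> t Q p \<Delta>' R)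
  from sized_lamS.prems[unfolded plus_fun_apply[of \<Gamma> \<Delta>' k]] obtain n1 n2 \<Delta>1 \<Delta>2 where *: "n = n1 + n2" "\<Delta> = \<Delta>1 + \<Delta>2"
    "sized n1 \<Delta>1 v (\<Gamma> k)" "sized n2 \<Delta>2 v (\<Delta>' k)"
    by (auto elim: sized_value_split)
  \<comment> \<open>Under the binder \<open>v\<close> is lifted, so its environment has
    \<open>0\<close> at the bound variable, and adding it leaves the type \<open>P\<close> there
    intact.\<close>
  have "sized (m + n1) (env_delete (Suc k) (case_nat P \<Gamma>) + case_nat 0 \<Delta>1)
      (subst (Suc k) (lift 0 v) t) Q"
    by (rule sized_lamS.IH(1))
      (use sized_lamS.prems sized_lift[OF *(3), of 0] in
        \<open>simp_all add: env_insert_zero[symmetric]\<close>)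
  then have "sized (m + n1) (case_nat P (env_delete k \<Gamma> + \<Delta>1)) (subst (Suc k) (lift 0 v) t) Q"
    by (simp add: env_delete_Suc case_nat_plus)
  moreover have "sized (p + n2) (env_delete k \<Delta>' + \<Delta>2) (Lam (subst (Suc k) (lift 0 v) t)) R"
    using sized_lamS.IH(2)[OF sized_lamS.prems(1) *(4)] by simp
  ultimately show ?case
    using sized.sized_lamS[of "m + n1" P "env_delete k \<Gamma> + \<Delta>1" _ Q]
    by (fastforce simp: *(1,2) env_delete_plus ac_simps)
next
  case (sized_app m \<Gamma> t P Q p \<Delta>' u)
  from sized_app.prems[unfolded plus_fun_apply[of \<Gamma> \<Delta>' k]] obtain n1 n2 \<Delta>1 \<Delta>2 where *: "n = n1 + n2" "\<Delta> = \<Delta>1 + \<Delta>2"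
    "sized n1 \<Delta>1 v (\<Gamma> k)" "sized n2 \<Delta>2 v (\<Delta>' k)"
    by (auto elim: sized_value_split)
  show ?case
    using sized.sized_app[OF sized_app.IH(1)[OF sized_app.prems(1) *(3)]
        sized_app.IH(2)[OF sized_app.prems(1) *(4)]]
    by (simp add: *(1,2) env_delete_plus ac_simps)
qed

text \<open>Converse of \<open>sized_subst\<close>: the derivations of the copies of
  \<open>v\<close> are collected and merged into one. Where no copy occurs, \<open>v\<close> is
  derived at type \<open>0\<close> with count 0, which every value allows.\<close>

lemma sized_unsubst:
  assumes "sized m \<Gamma> (subst k v t) Q" and "is_value v"
  shows "\<exists>m1 m2 \<Gamma>' \<Delta>. m = m1 + m2 \<and> \<Gamma> = env_delete k \<Gamma>' + \<Delta> \<and>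
    sized m1 \<Gamma>' t Q \<and> sized m2 \<Delta> v (\<Gamma>' k)"
  using assms
proof (induction t arbitrary: m \<Gamma> k v Q)
  case (Var x)
  show ?case
  proof (cases "x = k")
    case True
    have "env_delete k (env_of [k] [Q]) = 0"
      by (rule ext) (auto simp: env_delete_def env_of_single zero_fun_apply)
    moreover have "env_of [k] [Q] k = Q"
      by (simp add: env_of_single)
    moreover have "sized m \<Gamma> v Q"
      using Var True by simp
    ultimately show ?thesis
      using True sized_var[of k Q] by (metis add_0)
  next
    case False
    let ?y = "if x < k then x else x - 1"
    have "subst k v (Var x) = Var ?y"
      using False by simp
    then have "m = 0 \<and> \<Gamma> = env_of [?y] [Q]"
      using Var.prems(1) by (auto elim!: sized_VarE simp del: if_split)
    moreover have "env_delete k (env_of [x] [Q]) = env_of [?y] [Q]"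
      using False by (intro ext) (auto simp: env_delete_def env_of_single)
    moreover have "env_of [x] [Q] k = 0"
      using False by (simp add: env_of_single)
    ultimately show ?thesis
      using sized_var[of x Q] sized_value_0[OF Var.prems(2)] by (metis add_0_right)
  qed
next
  case (Lam t)
  have "sized m \<Gamma> (Lam (subst (Suc k) (lift 0 v) t)) Q"
    using Lam.prems by simp
  then show ?case
  proof (induction m \<Gamma> "Lam (subst (Suc k) (lift 0 v) t)" Q)
    case sized_lam0
    show ?case
      using sized.sized_lam0[of t] sized_value_0[OF Lam.prems(2)]
      by (metis add_0 env_delete_0 zero_fun_apply)
  next
    case (sized_lamS m P \<Gamma> Q n \<Delta> R)
    obtain m1 m2 \<Gamma>1 \<Delta>1 where 1: "m = m1 + m2" "case_nat P \<Gamma> = env_delete (Suc k) \<Gamma>1 + \<Delta>1"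
      "sized m1 \<Gamma>1 t Q" "sized m2 \<Delta>1 (lift 0 v) (\<Gamma>1 (Suc k))"
      using Lam.IH[OF sized_lamS(1)] Lam.prems(2) is_value_lift by blast
    obtain n1 n2 \<Gamma>2 \<Delta>2 where 2: "n = n1 + n2" "\<Delta> = env_delete k \<Gamma>2 + \<Delta>2"
      "sized n1 \<Gamma>2 (Lam t) R" "sized n2 \<Delta>2 v (\<Gamma>2 k)"
      using sized_lamS(4) by blast
    \<comment> \<open>The copies of \<open>v\<close> below the binder are lifted, so they give type
      \<open>0\<close> to the bound variable; all of \<open>P\<close> therefore comes from the body
      \<open>t\<close>.\<close>
    obtain \<Delta>1' where \<Delta>1': "\<Delta>1 = case_nat 0 \<Delta>1'" "sized m2 \<Delta>1' v (\<Gamma>1 (Suc k))"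
      using sized_unlift[OF 1(4)] by (auto simp: env_insert_zero)
    define \<Gamma>1' where "\<Gamma>1' = (\<lambda>i. \<Gamma>1 (Suc i))"
    have \<Gamma>1: "\<Gamma>1 = case_nat (\<Gamma>1 0) \<Gamma>1'"
      using case_nat_eq_iff[of "\<Gamma>1 0" \<Gamma>1' \<Gamma>1] by (simp add: \<Gamma>1'_def)
    have "case_nat P \<Gamma> = case_nat (\<Gamma>1 0) (env_delete k \<Gamma>1' + \<Delta>1')"
      using 1(2) by (subst (asm) \<Gamma>1) (simp add: env_delete_Suc case_nat_plus \<Delta>1'(1))
    then have \<Gamma>: "\<Gamma>1 0 = P" "\<Gamma> = env_delete k \<Gamma>1' + \<Delta>1'"
      by (simp_all add: case_nat_eq_iff)
    have "sized (m1 + n1) (\<Gamma>1' + \<Gamma>2) (Lam t) (Pos {#(P, Q)#} + R)"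
      using sized.sized_lamS[OF _ 2(3)] 1(3) \<Gamma>1 \<Gamma>(1) by metis
    \<comment> \<open>One derivation of \<open>v\<close> now serves both this premise and the
      remaining ones.\<close>
    moreover have "sized (m2 + n2) (\<Delta>1' + \<Delta>2) v ((\<Gamma>1' + \<Gamma>2) k)"
      using sized_value_merge[OF \<Delta>1'(2) 2(4) Lam.prems(2)] by (simp add: plus_fun_apply[of _ _ k] \<Gamma>1'_def)
    moreover have "m + n = (m1 + n1) + (m2 + n2)"
      using 1(1) 2(1) by simp
    moreover have "\<Gamma> + \<Delta> = env_delete k (\<Gamma>1' + \<Gamma>2) + (\<Delta>1' + \<Delta>2)"
      by (simp add: \<Gamma>(2) 2(2) env_delete_plus ac_simps)
    ultimately show ?case
      by blast
  qed
next
  case (App t u)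
  from App.prems have "sized m \<Gamma> (App (subst k v t) (subst k v u)) Q"
    by simp
  then obtain m1 m2 \<Gamma>1 \<Gamma>2 P where *: "m = Suc (m1 + m2)" "\<Gamma> = \<Gamma>1 + \<Gamma>2"
    "sized m1 \<Gamma>1 (subst k v t) (Pos {#(P, Q)#})" "sized m2 \<Gamma>2 (subst k v u) P"
    by (auto elim: sized_AppE)
  obtain p1 q1 \<Gamma>1' \<Delta>1 where 1: "m1 = p1 + q1" "\<Gamma>1 = env_delete k \<Gamma>1' + \<Delta>1"
    "sized p1 \<Gamma>1' t (Pos {#(P, Q)#})" "sized q1 \<Delta>1 v (\<Gamma>1' k)"
    using App.IH(1)[OF *(3) App.prems(2)] by blast
  obtain p2 q2 \<Gamma>2' \<Delta>2 where 2: "m2 = p2 + q2" "\<Gamma>2 = env_delete k \<Gamma>2' + \<Delta>2"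
    "sized p2 \<Gamma>2' u P" "sized q2 \<Delta>2 v (\<Gamma>2' k)"
    using App.IH(2)[OF *(4) App.prems(2)] by blast
  have "sized (q1 + q2) (\<Delta>1 + \<Delta>2) v ((\<Gamma>1' + \<Gamma>2') k)"
    using sized_value_merge[OF 1(4) 2(4) App.prems(2)] by (simp add: plus_fun_apply[of _ _ k])
  moreover have "m = Suc (p1 + p2) + (q1 + q2)"
    using *(1) 1(1) 2(1) by simp
  moreover have "\<Gamma> = env_delete k (\<Gamma>1' + \<Gamma>2') + (\<Delta>1 + \<Delta>2)"
    by (simp add: *(2) 1(2) 2(2) env_delete_plus ac_simps)
  ultimately show ?case
    using sized_app[OF 1(3) 2(3)] by blast
qed

section \<open>Subject reduction and expansion\<close>

text \<open>The \<open>Suc\<close> is the application rule of the redex itself. Its abstraction has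
  a singleton type, hence one premise, to which the substitution lemmas apply in either
  direction.\<close>

lemma sized_root_bv_iff:
  assumes "root_bv r s"
  shows "sized m \<Gamma> r Q \<longleftrightarrow> (\<exists>m'. m = Suc m' \<and> sized m' \<Gamma> s Q)"
  using assms
proof cases
  case (1 v t)
  show ?thesis
  proof
    assume "sized m \<Gamma> r Q"
    then obtain m1 m2 \<Gamma>1 \<Gamma>2 P where *: "m = Suc (m1 + m2)" "\<Gamma> = \<Gamma>1 + \<Gamma>2"
      "sized m1 \<Gamma>1 (Lam t) (Pos {#(P, Q)#})" "sized m2 \<Gamma>2 v P"
      unfolding 1 by (auto elim: sized_AppE)
    then have "sized (m1 + m2) (env_delete 0 (case_nat P \<Gamma>1) + \<Gamma>2) (subst 0 v t) Q"
      using 1 by (intro sized_subst) (auto simp: sized_Lam_single_iff)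
    then show "\<exists>m'. m = Suc m' \<and> sized m' \<Gamma> s Q"
      using * 1 by (auto simp: env_delete_zero)
  next
    assume "\<exists>m'. m = Suc m' \<and> sized m' \<Gamma> s Q"
    then obtain m1 m2 \<Gamma>' \<Delta> where *: "m = Suc (m1 + m2)" "\<Gamma> = env_delete 0 \<Gamma>' + \<Delta>"
      "sized m1 \<Gamma>' t Q" "sized m2 \<Delta> v (\<Gamma>' 0)"
      using 1 sized_unsubst by blast
    \<comment> \<open>Splitting off the entry at index 0 turns the recovered environment into that
      of an abstraction premise.\<close>
    have "\<Gamma>' = case_nat (\<Gamma>' 0) (env_delete 0 \<Gamma>')"
      by (rule ext) (simp add: env_delete_def split: nat.split)
    then have "sized m1 (env_delete 0 \<Gamma>') (Lam t) (Pos {#(\<Gamma>' 0, Q)#})"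
      using *(3) by (simp add: sized_Lam_single_iff)
    then show "sized m \<Gamma> r Q"
      using sized_app[OF _ *(4)] *(1,2) 1 by simp
  qed
qed

section \<open>Contexts: balanced ones with counts, arbitrary ones without\<close>

text \<open>A balanced context goes under an abstraction only when it is applied, so its type is a
  singleton and the body is typed exactly once. Thus the hole is never duplicated or left untyped,
  and its decrease carries over.\<close>

lemma sized_balanced_decreases:
  assumes "balanced B" and "root_bv r s" and "sized m \<Gamma> (plug B r) Q"
  shows "\<exists>m'<m. sized m' \<Gamma> (plug B s) Q"
  using assms(1,3)
proof (induction arbitrary: m \<Gamma> Q)
  case 1
  then show ?case
    using sized_root_bv_iff[OF assms(2)] by auto
next
  case (2 B t)
  then obtain m1 m2 \<Gamma>1 \<Gamma>2 P where *: "m = Suc (m1 + m2)" "\<Gamma> = \<Gamma>1 + \<Gamma>2"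
    "sized m1 (case_nat P \<Gamma>1) (plug B r) Q" "sized m2 \<Gamma>2 t P"
    by (auto elim: sized_AppE simp: sized_Lam_single_iff)
  obtain m' where "m' < m1" "sized m' \<Gamma>1 (Lam (plug B s)) (Pos {#(P, Q)#})"
    using 2(2)[OF *(3)] by (auto simp: sized_Lam_single_iff)
  then show ?case
    using sized_app[OF _ *(4)] *(1,2) by (intro exI[of _ "Suc (m' + m2)"]) auto
next
  case (3 B t)
  then obtain m1 m2 \<Gamma>1 \<Gamma>2 P where *: "m = Suc (m1 + m2)" "\<Gamma> = \<Gamma>1 + \<Gamma>2"
    "sized m1 \<Gamma>1 (plug B r) (Pos {#(P, Q)#})" "sized m2 \<Gamma>2 t P"
    by (auto elim: sized_AppE)
  obtain m' where "m' < m1" "sized m' \<Gamma>1 (plug B s) (Pos {#(P, Q)#})"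
    using 3(2)[OF *(3)] by blast
  then show ?case
    using sized_app[OF _ *(4)] *(1,2) by (intro exI[of _ "Suc (m' + m2)"]) auto
next
  case (4 B t)
  then obtain m1 m2 \<Gamma>1 \<Gamma>2 P where *: "m = Suc (m1 + m2)" "\<Gamma> = \<Gamma>1 + \<Gamma>2"
    "sized m1 \<Gamma>1 t (Pos {#(P, Q)#})" "sized m2 \<Gamma>2 (plug B r) P"
    by (auto elim: sized_AppE)
  obtain m' where "m' < m2" "sized m' \<Gamma>2 (plug B s) P"
    using 4(2)[OF *(4)] by blast
  then show ?case
    using sized_app[OF *(3)] *(1,2) by (intro exI[of _ "Suc (m1 + m')"]) auto
qed

text \<open>An abstraction in a general context may have any number of premises, even none, so no
  decrease of the count is claimed; replacing \<open>r\<close> in each premise still preserves the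
  typing. The one-sided form serves both reduction and expansion.\<close>

lemma derivable_plug_mono:
  assumes "\<And>\<Gamma> Q. derivable \<Gamma> r Q \<Longrightarrow> derivable \<Gamma> s Q"
  shows "derivable \<Gamma> (plug C r) Q \<Longrightarrow> derivable \<Gamma> (plug C s) Q"
proof (induction C arbitrary: \<Gamma> Q)
  case (CLam C)
  then show ?case
    by (auto dest!: derivable_LamD intro!: derivable.lam simp del: mset_map)
next
  case (CAppL C t)
  from CAppL.prems show ?case
    by (cases rule: derivable.cases) (auto intro: CAppL.IH derivable.app)
next
  case (CAppR t C)
  from CAppR.prems show ?case
    by (cases rule: derivable.cases) (auto intro: CAppR.IH derivable.app)
qed (simp add: assms)

lemma derivable_bv_iff:
  assumes "bv t u"
  shows "derivable \<Gamma> t Q \<longleftrightarrow> derivable \<Gamma> u Q"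
proof -
  obtain C r s where *: "root_bv r s" "t = plug C r" "u = plug C s"
    using assms by (auto simp: bv_def)
  then have "derivable \<Gamma> r Q \<longleftrightarrow> derivable \<Gamma> s Q" for \<Gamma> Q
    by (auto simp: derivable_iff_sized sized_root_bv_iff)
  then show ?thesis
    using derivable_plug_mono *(2,3) by metis
qed

lemma derivable_equivclp_bv_iff:
  "equivclp bv t u \<Longrightarrow> derivable \<Gamma> t Q \<longleftrightarrow> derivable \<Gamma> u Q"
  by (induction rule: equivclp_induct) (auto simp: derivable_bv_iff)

section \<open>Normalization\<close>

text \<open>Strong induction on the count: the first step of an infinite reduction lowers it, while
  the tail would again be infinite.\<close>

lemma sized_strongly_normalizable:
  "sized m \<Gamma> t Q \<Longrightarrow> strongly_normalizable bal_bv t"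
proof (induction m arbitrary: t rule: less_induct)
  case (less m)
  show ?case
    unfolding strongly_normalizable_def
  proof
    assume "\<exists>f. f 0 = t \<and> (\<forall>i. bal_bv (f i) (f (Suc i)))"
    then obtain f where f: "f 0 = t" "\<And>i. bal_bv (f i) (f (Suc i))"
      by blast
    from f(2)[of 0] obtain m' where "m' < m" "sized m' \<Gamma> (f 1) Q"
      using less.prems f(1) sized_balanced_decreases by (fastforce simp: bal_bv_def)
    then have "strongly_normalizable bal_bv (f 1)"
      using less.IH by blast
    moreover have "\<exists>g. g 0 = f 1 \<and> (\<forall>i. bal_bv (g i) (g (Suc i)))"
      by (rule exI[of _ "\<lambda>i. f (Suc i)"]) (simp add: f(2))
    ultimately show False
      unfolding strongly_normalizable_def by blast
  qed
qed

lemma strongly_normalizable_imp_normalizable: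
  assumes "strongly_normalizable R t"
  shows "normalizable R t"
proof (rule ccontr)
  assume "\<not> normalizable R t"
  \<comment> \<open>Without a reachable normal form, every term reachable from \<open>t\<close> has
    a successor, so dependent choice builds an infinite reduction; the clause for
    \<open>n = 0\<close> below makes it start at \<open>t\<close>.\<close>
  then have step: "\<exists>u. R\<^sup>*\<^sup>* t u \<and> R s u" if "R\<^sup>*\<^sup>* t s" for s
    using that by (metis normal_for_def normalizable_def rtranclp.rtrancl_into_rtrancl)
  have "\<exists>f. \<forall>n. (R\<^sup>*\<^sup>* t (f n) \<and> (n = 0 \<longrightarrow> f n = t)) \<and> R (f n) (f (Suc n))"
    by (rule dependent_nat_choice) (use step in auto)
  then show False
    using assms unfolding strongly_normalizable_def by blast
qed

section \<open>Closedness along reduction\<close>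

text \<open>Closedness is the case \<open>n = 0\<close> of a bound on the free indices. The general
  bound is what can pass under a binder, where it grows by one.\<close>

lemma fv_Lam_bound_iff: "fv (Lam t) \<subseteq> {..<n} \<longleftrightarrow> fv t \<subseteq> {..<Suc n}"
proof -
  have "i < Suc n" if "\<forall>j. Suc j \<in> fv t \<longrightarrow> j < n" "i \<in> fv t" for i
    using that by (cases i) auto
  then show ?thesis
    by (auto simp: subset_iff)
qed

lemma fv_lift_bound: "fv t \<subseteq> {..<n} \<Longrightarrow> fv (lift k t) \<subseteq> {..<Suc n}"
proof (induction t arbitrary: n k)
  case (Lam t)
  then show ?case
    by (simp add: fv_Lam_bound_iff del: fv.simps(2))
qed auto

lemma fv_subst_bound:
  "fv t \<subseteq> {..<Suc n} \<Longrightarrow> fv v \<subseteq> {..<n} \<Longrightarrow> k \<le> n \<Longrightarrow> fv (subst k v t) \<subseteq> {..<n}"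
proof (induction t arbitrary: n k v)
  case (Lam t)
  then show ?case
    by (simp add: fv_Lam_bound_iff fv_lift_bound del: fv.simps(2))
qed auto

lemma fv_plug_bound:
  assumes "root_bv r s" and "fv (plug C r) \<subseteq> {..<n}"
  shows "fv (plug C s) \<subseteq> {..<n}"
  using assms(2)
proof (induction C arbitrary: n)
  case Hole
  from assms(1) show ?case
  proof cases
    case (1 v t)
    have "fv t \<subseteq> {..<Suc n}"
      using Hole 1 by (simp add: fv_Lam_bound_iff del: fv.simps(2))
    then show ?thesis
      using Hole 1 fv_subst_bound[of t n v 0] by simp
  qed
next
  case (CLam C)
  then show ?case
    by (simp add: fv_Lam_bound_iff del: fv.simps(2))
qed auto

lemma closed_bal_bv_rtranclp: "bal_bv\<^sup>*\<^sup>* t u \<Longrightarrow> closed_tm t \<Longrightarrow> closed_tm u"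
proof (induction rule: rtranclp_induct)
  case (step u w)
  then show ?case
    using fv_plug_bound[of _ _ _ 0] by (fastforce simp: bal_bv_def closed_tm_def)
qed

lemma bal_bv_AppL: "bal_bv t t' \<Longrightarrow> bal_bv (App t u) (App t' u)"
  unfolding bal_bv_def by (metis balanced.intros(3) plug.simps(3))

lemma bal_bv_AppR: "bal_bv u u' \<Longrightarrow> bal_bv (App t u) (App t u')"
  unfolding bal_bv_def by (metis balanced.intros(4) plug.simps(4))

text \<open>In a closed normal application both parts would be values by induction. The function
  part, being closed, is no variable but an abstraction, so the application would be a
  redex.\<close>

lemma closed_normal_is_value:
  "closed_tm t \<Longrightarrow> normal_for bal_bv t \<Longrightarrow> is_value t"
proof (induction t)
  case (App t u)
  have c: "closed_tm t" "closed_tm u"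
    using App.prems(1) by (auto simp: closed_tm_def)
  have "normal_for bal_bv t" "normal_for bal_bv u"
    using App.prems(2) bal_bv_AppL bal_bv_AppR unfolding normal_for_def by blast+
  then have "is_value t" "is_value u"
    using App.IH c by auto
  then obtain s where "t = Lam s"
    using c by (cases t) (auto simp: closed_tm_def)
  then have "bal_bv (App t u) (subst 0 u s)"
    using \<open>is_value u\<close> unfolding bal_bv_def
    by (metis balanced.intros(1) plug.simps(1) root_bv.intros)
  then show ?case
    using App.prems(2) by (auto simp: normal_for_def)
qed auto

lemma bal_bv_imp_bv: "bal_bv t u \<Longrightarrow> bv t u"
  by (auto simp: bal_bv_def bv_def)

lemma value_derivable_0:
  assumes "is_value v"
  shows "derivable (\<lambda>_. 0) v 0"
  using sized_value_0[OF assms] by (auto simp: derivable_iff_sized zero_fun_def)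

lemma env_of_replicate_0: "env_of xs (replicate (length xs) 0) = (\<lambda>_. 0)"
proof -
  have "env_of xs (replicate (length xs) 0) y = 0" for y
    by (induction xs) (auto simp: env_of_def)
  then show ?thesis
    by blast
qed

theorem mainTheorem6:
  fixes t :: tm
  assumes "closed_tm t"
  shows
   "(normalizable bal_bv t \<longleftrightarrow> (\<exists>v. is_value v \<and> closed_tm v \<and> bal_bv\<^sup>*\<^sup>* t v)) \<and>
    (normalizable bal_bv t \<longleftrightarrow> (\<exists>v. is_value v \<and> closed_tm v \<and> equivclp bv t v)) \<and>
    (normalizable bal_bv t \<longleftrightarrow> (\<forall>xs. distinct xs \<longrightarrow> sem xs t \<noteq> {})) \<and>
    (normalizable bal_bv t \<longleftrightarrow>
       (\<forall>xs. distinct xs \<longrightarrow> (replicate (length xs) 0, 0) \<in> sem xs t)) \<and>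
    (normalizable bal_bv t \<longleftrightarrow> derivable (\<lambda>_. 0) t 0) \<and>
    (normalizable bal_bv t \<longleftrightarrow> (\<exists>Q. derivable (\<lambda>_. 0) t Q)) \<and>
    (normalizable bal_bv t \<longleftrightarrow> strongly_normalizable bal_bv t)"
proof -
  let ?N = "normalizable bal_bv t"
  let ?V = "\<exists>v. is_value v \<and> closed_tm v \<and> bal_bv\<^sup>*\<^sup>* t v"
  let ?E = "\<exists>v. is_value v \<and> closed_tm v \<and> equivclp bv t v"
  let ?S = "\<forall>xs. distinct xs \<longrightarrow> sem xs t \<noteq> {}"
  let ?Z = "\<forall>xs. distinct xs \<longrightarrow> (replicate (length xs) 0, 0) \<in> sem xs t"
  let ?O = "derivable (\<lambda>_. 0) t 0"
  let ?D = "\<exists>Q. derivable (\<lambda>_. 0) t Q"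
  let ?SN = "strongly_normalizable bal_bv t"
  \<comment> \<open>The conditions are linked in one cycle, from \<open>?N\<close> through
    \<open>?V\<close>, \<open>?E\<close>, \<open>?O\<close>, \<open>?Z\<close>, \<open>?S\<close>,
    \<open>?D\<close> and \<open>?SN\<close> back to \<open>?N\<close>.\<close>
  have "?V" if "?N"
    using that assms closed_bal_bv_rtranclp closed_normal_is_value
    unfolding normalizable_def by blast
  moreover have "?E" if V: "?V"
  proof -
    obtain v where v: "is_value v" "closed_tm v" "bal_bv\<^sup>*\<^sup>* t v"
      using V by blast
    from v(3) have "equivclp bv t v"
      by induction (auto intro: equivclp_into_equivclp bal_bv_imp_bv)
    with v show ?thesis by blast
  qed
  \<comment> \<open>The type \<open>0\<close> of the value is carried back to \<open>t\<close> along
    the equivalence.\<close>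
  moreover have "?O" if "?E"
    using that value_derivable_0 derivable_equivclp_bv_iff by blast
  moreover have "?Z" if "?O"
    using that by (simp add: sem_def env_of_replicate_0)
  moreover have "?S" if "?Z"
    using that by blast
  moreover have "?D" if "?S"
  proof -
    \<comment> \<open>For the empty list of variables the environment is empty, as \<open>?D\<close>
      requires.\<close>
    have "sem [] t \<noteq> {}"
      using that by simp
    then show ?thesis
      by (auto simp: sem_def env_of_def)
  qed
  moreover have "?SN" if "?D"
    using that sized_strongly_normalizable by (auto simp: derivable_iff_sized)
  moreover have "?N" if "?SN"
    using that by (rule strongly_normalizable_imp_normalizable)
  ultimately show ?thesis
    by argo
qed

end
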